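(* Let $\mathcal{X}=\{x\in\mathbb{R}^d: Ax=b,\ x\ge0\}$ be a nonempty bounded nondegenerate polytope with $A\in\mathbb{R}^{m\times d}$ of full row rank, let $\mathcal{C}\subseteq\mathbb{R}^d$ be convex, let $c\in\mathcal{C}$, and let $d^\star=\dim\operatorname{dir}(\mathcal{X}^\star(\mathcal{C}))$. Then the facet-hit cutting-plane algorithm (Algorithm 1, described in the context) terminates after at most $d^\star+1$ iterations and returns a dataset $\mathcal{D}$ that is pointwise sufficient at $c$.
   Context: Nondegenerate: every extreme point of $\mathcal{X}$ has exactly $m$ strictly positive components. $\mathcal{X}^\angle$ is the set of extreme points, $\mathcal{X}^\star(c):=\operatorname{argmin}_{x\in\mathcal{X}}c^\top x$, $\mathcal{X}^\star(\mathcal{C}):=\bigcup_{c\in\mathcal{C}}(\mathcal{X}^\star(c)\cap\mathcal{X}^\angle)$, $\operatorname{dir}(\mathcal{X}^\star(\mathcal{C})):=\operatorname{span}\{x-x':x,x'\in\mathcal{X}^\star(\mathcal{C})\}$. A dataset is a finite set $\mathcal{D}=\{q_1,\dots,q_l\}\subset\mathbb{R}^d$; $s(c;\mathcal{D}):=(q_1^\top c,\dots,q_l^\top c)$; the fiber is $\mathcal{C}(\mathcal{D},s):=\{c'\in\mathcal{C}: q_i^\top c'=s_i\ \forall i\}$. $\mathcal{D}$ is pointwise sufficient at $c$ if there is $x^\star\in\mathcal{X}$ with $x^\star\in\mathcal{X}^\star(c')$ for all $c'\in\mathcal{C}(\mathcal{D},s(c;\mathcal{D}))$. For a basis $B\subseteq\{1,\dots,d\}$,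 $|B|=m$ ($A_B$ invertible), with complement $N$, the basic solution $x(B)$ has $x_N(B)=0$, $x_B(B)=A_B^{-1}b$. For $j\in N$, the edge direction $\delta(B,j)\in\mathbb{R}^d$ has $\delta_N(B,j)=e_j$ and $\delta_B(B,j)=-A_B^{-1}A_j$, where $A_j$ is the $j$th column of $A$. Algorithm 1. Input: $(A,b)$, $\mathcal{C}$, $c\in\mathcal{C}$, and an initial finite dataset $\mathcal{D}_{\mathrm{init}}\subset\mathbb{R}^d$. Set $\mathcal{D}\leftarrow\mathcal{D}_{\mathrm{init}}$. Repeat the following iteration: 1. Let $k=|\mathcal{D}|$, $\mathcal{C}_k:=\mathcal{C}(\mathcal{D},s(c;\mathcal{D}))$, $c^{\mathrm{in}}:=c$. 2. Solve $\min\{(c^{\mathrm{in}})^\top x: x\in\mathcal{X}\}$, obtaining an optimal feasible basis $B$ with nonbasis $N$. 3. For each $j\in N$ let $\delta_j:=\delta(B,j)$, $m_j:=\min_{c'\in\mathcal{C}_k}(c')^\top\delta_j$ and let $c^{\mathrm{out}}_j$ be a minimizer (if the infimum is not attained, $m_j$ is the infimum and, when $m_j<0$, $c_j^{\mathrm{out}}$ is any point of $\mathcal{C}_k$ with $(c_j^{\mathrm{out}})^\top\delta_j<0$). 4. Let $j_0\in\operatorname{argmin}_{j\in N}m_j$, $m_{\min}:=m_{j_0}$, $c^{\mathrm{out}}:=c^{\mathrm{out}}_{j_0}$. 5. If $m_{\min}\ge0$, return $\mathcal{D}$ (with certificate basis $B$, decision $x(B)$) and stop. 6. Otherwise, for each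 $j\in N$ with $(c^{\mathrm{out}})^\top\delta_j<0$ set $\alpha_j:=\frac{(c^{\mathrm{in}})^\top\delta_j}{(c^{\mathrm{in}})^\top\delta_j-(c^{\mathrm{out}})^\top\delta_j}\in[0,1)$, pick $j^\star\in\operatorname{argmin}_j\alpha_j$, set $q_{k+1}:=\delta_{j^\star}$ (the new queried direction, measured as $q_{k+1}^\top c$), and set $\mathcal{D}\leftarrow\mathcal{D}\cup\{q_{k+1}\}$. *)

theory Defs
  imports "HOL-Analysis.Analysis"
begin

section \<open>Linear programs in standard form\<close>

definition feasible_set :: "real^'d^'m \<Rightarrow> real^'m \<Rightarrow> (real^'d) set" where
  "feasible_set A b = {x. A *v x = b \<and> (\<forall>i. 0 \<le> x $ i)}"

definition nondegenerate :: "real^'d^'m \<Rightarrow> real^'m \<Rightarrow> bool" where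
  "nondegenerate A b \<longleftrightarrow>
     (\<forall>x. x extreme_point_of feasible_set A b \<longrightarrow> card {i. 0 < x $ i} = CARD('m))"

definition optimal_set :: "(real^'d) set \<Rightarrow> real^'d \<Rightarrow> (real^'d) set" where
  "optimal_set X c = {x. is_arg_min (\<lambda>y. c \<bullet> y) (\<lambda>y. y \<in> X) x}"

definition optimal_vertices :: "(real^'d) set \<Rightarrow> (real^'d) set \<Rightarrow> (real^'d) set" where
  "optimal_vertices X C = (\<Union>c\<in>C. optimal_set X c \<inter> {x. x extreme_point_of X})"

definition direction_space :: "(real^'d) set \<Rightarrow> (real^'d) set" where
  "direction_space S = span {x - x' |x x'. x \<in> S \<and> x' \<in> S}"


section \<open>Datasets\<close>

text \<open>The vector of measurements is indexed by the queries themselves, so that no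
  enumeration of the finite set \<open>D\<close> has to be fixed.\<close>

definition measurements :: "real^'d \<Rightarrow> (real^'d) set \<Rightarrow> real^'d \<Rightarrow> real" where
  "measurements c D = restrict (\<lambda>q. q \<bullet> c) D"

definition fiber :: "(real^'d) set \<Rightarrow> (real^'d) set \<Rightarrow> (real^'d \<Rightarrow> real) \<Rightarrow> (real^'d) set" where
  "fiber C D s = {c' \<in> C. \<forall>q\<in>D. q \<bullet> c' = s q}"

definition pointwise_sufficient ::
  "(real^'d) set \<Rightarrow> (real^'d) set \<Rightarrow> real^'d \<Rightarrow> (real^'d) set \<Rightarrow> bool" where
  "pointwise_sufficient X C c D \<longleftrightarrow>
     (\<exists>x\<in>X. \<forall>c'\<in>fiber C D (measurements c D). x \<in> optimal_set X c')"


section \<open>Bases, basic solutions and edge directions\<close>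

text \<open>A set \<open>B\<close> of \<open>m\<close> column indices is enumerated by the row index type \<open>'m\<close>, which makes
  \<open>A\<^sub>B\<close> a square matrix. All enumerations of \<open>B\<close> yield the same basic solution and the same
  edge directions.\<close>

definition basis_enum :: "'d set \<Rightarrow> 'm::finite \<Rightarrow> 'd" where
  "basis_enum B = (SOME \<beta>. bij_betw \<beta> UNIV B)"

definition basis_matrix :: "real^'d^'m \<Rightarrow> 'd set \<Rightarrow> real^'m^'m" where
  "basis_matrix A B = (\<chi> i k. A $ i $ basis_enum B k)"

definition is_basis :: "real^'d^'m \<Rightarrow> 'd set \<Rightarrow> bool" where
  "is_basis A B \<longleftrightarrow> card B = CARD('m) \<and> invertible (basis_matrix A B)"

text \<open>The entry of \<open>A\<^sub>B\<^sup>-\<^sup>1 y\<close> belonging to the column index \<open>i \<in> B\<close>.\<close>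

definition basis_coord :: "real^'d^'m \<Rightarrow> 'd set \<Rightarrow> real^'m \<Rightarrow> 'd \<Rightarrow> real" where
  "basis_coord A B y i = (matrix_inv (basis_matrix A B) *v y) $ inv_into UNIV (basis_enum B) i"

definition basic_solution :: "real^'d^'m \<Rightarrow> real^'m \<Rightarrow> 'd set \<Rightarrow> real^'d" where
  "basic_solution A b B = (\<chi> i. if i \<in> B then basis_coord A B b i else 0)"

definition edge_direction :: "real^'d^'m \<Rightarrow> 'd set \<Rightarrow> 'd \<Rightarrow> real^'d" where
  "edge_direction A B j =
     (\<chi> i. if i \<in> B then - basis_coord A B (column j A) i else if i = j then 1 else 0)"

definition optimal_feasible_basis :: "real^'d^'m \<Rightarrow> real^'m \<Rightarrow> real^'d \<Rightarrow> 'd set \<Rightarrow> bool" where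
  "optimal_feasible_basis A b c B \<longleftrightarrow>
     is_basis A B \<and> basic_solution A b B \<in> optimal_set (feasible_set A b) c"


section \<open>The facet-hit cutting-plane algorithm\<close>

text \<open>The infimum may be \<open>-\<infinity>\<close>, since \<open>K\<close> need not be bounded.\<close>

definition min_value :: "(real^'d) set \<Rightarrow> real^'d \<Rightarrow> ereal" where
  "min_value K \<delta> = (INF c'\<in>K. ereal (c' \<bullet> \<delta>))"

definition minimizer_choice :: "(real^'d) set \<Rightarrow> real^'d \<Rightarrow> real^'d \<Rightarrow> bool" where
  "minimizer_choice K \<delta> v \<longleftrightarrow>
     (if \<exists>w. is_arg_min (\<lambda>c'. c' \<bullet> \<delta>) (\<lambda>c'. c' \<in> K) w
      then is_arg_min (\<lambda>c'. c' \<bullet> \<delta>) (\<lambda>c'. c' \<in> K) v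
      else min_value K \<delta> < 0 \<longrightarrow> v \<in> K \<and> v \<bullet> \<delta> < 0)"

definition hit_ratio :: "real^'d \<Rightarrow> real^'d \<Rightarrow> real^'d \<Rightarrow> real" where
  "hit_ratio cin cout \<delta> = (cin \<bullet> \<delta>) / (cin \<bullet> \<delta> - cout \<bullet> \<delta>)"

text \<open>\<open>Returned D B x\<close> carries the dataset, the certificate basis and the decision.\<close>

datatype ('d::finite) alg_state =
    Running "(real^'d) set"
  | Returned "(real^'d) set" "'d set" "real^'d"

text \<open>One pass through the loop, as a relation because the optimal basis, the minimizers and
  the two indices are chosen arbitrarily among the admissible ones. For an empty nonbasis the
  infimum in \<open>stop\<close> is \<open>\<infinity>\<close>, so the algorithm stops.\<close>

inductive iteration ::
  "real^'d^'m \<Rightarrow> real^'m \<Rightarrow> (real^'d) set \<Rightarrow> real^'d \<Rightarrow> 'd alg_state \<Rightarrow> 'd alg_state \<Rightarrow> bool"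
  for A :: "real^'d^'m" and b :: "real^'m" and C :: "(real^'d) set" and c :: "real^'d"
where
  stop: "iteration A b C c (Running D) (Returned D B (basic_solution A b B))"
    if "optimal_feasible_basis A b c B"
      and "K = fiber C D (measurements c D)"
      and "0 \<le> (INF j\<in>-B. min_value K (edge_direction A B j))"
| query: "iteration A b C c (Running D) (Running (insert (edge_direction A B jstar) D))"
    if "optimal_feasible_basis A b c B"
      and "K = fiber C D (measurements c D)"
      and "\<forall>j\<in>-B. minimizer_choice K (edge_direction A B j) (cout j)"
      and "is_arg_min (\<lambda>j. min_value K (edge_direction A B j)) (\<lambda>j. j \<in> -B) j0"
      and "min_value K (edge_direction A B j0) < 0"
      and "is_arg_min (\<lambda>j. hit_ratio c (cout j0) (edge_direction A B j))
             (\<lambda>j. j \<in> -B \<and> cout j0 \<bullet> edge_direction A B j < 0) jstar"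

end

theory Submission
  imports Defs
begin

text \<open>
  Two facts about a query carry the proof. Write \<open>\<delta>\<close> for the queried edge direction at the optimal
  basis \<open>B\<close>, \<open>v\<close> for the violating cost vector \<open>c\<^sup>o\<^sup>u\<^sup>t\<close>, and \<open>W\<close> for the direction space of the
  optimal vertices.

  First, \<open>\<delta>\<close> is not in the span of the current dataset: \<open>v\<close> and \<open>c\<close> have the same measurements, so
  \<open>v - c\<close> is orthogonal to that span, whereas \<open>(v - c) \<bullet> \<delta> < 0\<close>, because \<open>v \<bullet> \<delta> < 0\<close> and, by
  optimality of \<open>B\<close>, \<open>c \<bullet> \<delta> \<ge> 0\<close> (\<open>reduced_cost_nonneg\<close>).

  Second, \<open>\<delta>\<close> is in \<open>W\<close>. Move the cost vector from \<open>c\<close> towards \<open>v\<close>. The minimal hit ratio is the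
  last moment before a reduced cost of \<open>B\<close> becomes negative, and the reduced cost of \<open>\<delta>\<close> is then zero
  (\<open>facet_hit\<close>). The cost vector \<open>w\<close> reached is in \<open>C\<close> by convexity, the basic solution of \<open>B\<close> is still
  optimal for it, and \<open>w \<bullet> \<delta> = 0\<close>. By nondegeneracy a short step along \<open>\<delta>\<close> stays feasible, so it joins
  two optimal points for \<open>w\<close>. By the Krein--Milman theorem the optimal face is the convex hull of its
  vertices, so the difference of two optimal points is in \<open>W\<close>
  (\<open>optimal_difference_in_direction_space\<close>). This replaces the ratio test that would locate the
  adjacent vertex.

  Hence the queries made by the algorithm are linearly independent vectors of \<open>W\<close>, and there are at
  most \<open>dim W\<close> of them; the returning iteration adds one. If the algorithm stops at a basis \<open>B\<close>, then
  all reduced costs of \<open>B\<close> are nonnegative for every cost vector of the fiber, so the basic solution is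
  optimal on the whole fiber. An iteration is always possible because some vertex is optimal and, by
  nondegeneracy, the support of a vertex is a basis.
\<close>

section \<open>Basic solutions and edge directions\<close>

lemma basis_enum_bij:
  fixes B :: "'d::finite set"
  assumes "card B = CARD('m::finite)"
  shows "bij_betw (basis_enum B :: 'm \<Rightarrow> 'd) UNIV B"
proof -
  have "\<exists>\<beta> :: 'm \<Rightarrow> 'd. bij_betw \<beta> UNIV B"
    using assms by (intro finite_same_card_bij) auto
  then show ?thesis
    unfolding basis_enum_def by (rule someI_ex)
qed

lemma mult_supported_on_basis:
  fixes A :: "real^'d^'m"
  assumes "card B = CARD('m)" and "\<And>i. i \<notin> B \<Longrightarrow> v $ i = 0"
  shows "A *v v = basis_matrix A B *v (\<chi> k. v $ basis_enum B k)"
proof -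
  have "(\<Sum>i\<in>UNIV. A $ r $ i * v $ i)
      = (\<Sum>k\<in>UNIV. A $ r $ basis_enum B k * v $ basis_enum B (k::'m))" for r
  proof -
    have "(\<Sum>i\<in>UNIV. A $ r $ i * v $ i) = (\<Sum>i\<in>B. A $ r $ i * v $ i)"
      using assms(2) by (intro sum.mono_neutral_right) auto
    also have "\<dots> = (\<Sum>k\<in>UNIV. A $ r $ basis_enum B k * v $ basis_enum B (k::'m))"
      by (rule sum.reindex_bij_betw [OF basis_enum_bij [OF assms(1)], symmetric])
    finally show ?thesis .
  qed
  then show ?thesis
    by (simp add: vec_eq_iff matrix_vector_mult_def basis_matrix_def)
qed

lemma basis_kernel_trivial:
  fixes A :: "real^'d^'m"
  assumes "is_basis A B" and "\<And>i. i \<notin> B \<Longrightarrow> v $ i = 0" and "A *v v = 0"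
  shows "v = 0"
proof -
  have card: "card B = CARD('m)" and inv: "invertible (basis_matrix A B)"
    using assms(1) by (auto simp: is_basis_def)
  let ?w = "\<chi> k. v $ (basis_enum B (k::'m))"
  have "basis_matrix A B *v ?w = 0"
    using mult_supported_on_basis [OF card assms(2)] assms(3) by simp
  then have w: "?w = 0"
    using inv by (metis matrix_left_invertible_ker invertible_left_inverse)
  have "v $ i = 0" for i
  proof (cases "i \<in> B")
    case True
    then obtain k :: 'm where "i = basis_enum B k"
      using basis_enum_bij [OF card] by (auto simp: bij_betw_def)
    then show ?thesis
      using w by (simp add: vec_eq_iff)
  qed (use assms(2) in auto)
  then show ?thesis
    by (simp add: vec_eq_iff)
qed

lemma matrix_mul_matrix_inv:
  assumes "invertible M"
  shows "M ** matrix_inv M = mat 1"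
  using assms unfolding invertible_def matrix_inv_def
  by (rule someI2_ex) simp

lemma mult_basic_solution:
  fixes A :: "real^'d^'m"
  assumes "is_basis A B"
  shows "A *v basic_solution A y B = y"
proof -
  have card: "card B = CARD('m)" and inv: "invertible (basis_matrix A B)"
    using assms by (auto simp: is_basis_def)
  note bij = basis_enum_bij [OF card]
  have "(\<chi> k. basic_solution A y B $ basis_enum B k) = matrix_inv (basis_matrix A B) *v y"
    using bij by (auto simp: vec_eq_iff basic_solution_def basis_coord_def bij_betw_def)
  moreover have "A *v basic_solution A y B
      = basis_matrix A B *v (\<chi> k. basic_solution A y B $ basis_enum B k)"
    by (rule mult_supported_on_basis [OF card]) (simp add: basic_solution_def)
  ultimately show ?thesis
    using matrix_mul_matrix_inv [OF inv] by (simp add: matrix_vector_mul_assoc)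
qed

lemma basic_solution_outside: "i \<notin> B \<Longrightarrow> basic_solution A b B $ i = 0"
  by (simp add: basic_solution_def)

lemma edge_direction_outside:
  "i \<notin> B \<Longrightarrow> edge_direction A B j $ i = (if i = j then 1 else 0)"
  by (simp add: edge_direction_def)

lemma mult_edge_direction:
  fixes A :: "real^'d^'m"
  assumes "is_basis A B" and "j \<notin> B"
  shows "A *v edge_direction A B j = 0"
proof -
  have "edge_direction A B j = axis j 1 - basic_solution A (column j A) B"
    using assms(2)
    by (auto simp: vec_eq_iff edge_direction_def basic_solution_def axis_def)
  then show ?thesis
    by (simp add: matrix_vector_mult_diff_distrib matrix_vector_mul_component
        mult_basic_solution [OF assms(1)] matrix_vector_mult_basis)
qed

text \<open>The edge directions are dual to the nonbasic coordinates: both sides below agree off \<open>B\<close>, and a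
  vector is determined by its image under \<open>A\<close> and its coordinates off \<open>B\<close>.\<close>

lemma feasible_eq_basic_solution_plus_edges:
  fixes A :: "real^'d^'m"
  assumes "is_basis A B" and "A *v x = b"
  shows "x = basic_solution A b B + (\<Sum>j\<in>-B. x $ j *\<^sub>R edge_direction A B j)"
proof -
  let ?v = "x - basic_solution A b B - (\<Sum>j\<in>-B. x $ j *\<^sub>R edge_direction A B j)"
  have "?v $ i = 0" if "i \<notin> B" for i
  proof -
    have "(\<Sum>j\<in>-B. x $ j * edge_direction A B j $ i) = (\<Sum>j\<in>-B. if j = i then x $ j else 0)"
      using that by (intro sum.cong) (auto simp: edge_direction_outside)
    then show ?thesis
      using that by (simp add: basic_solution_outside)
  qed
  moreover have "A *v (\<Sum>j\<in>-B. x $ j *\<^sub>R edge_direction A B j)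
      = (\<Sum>j\<in>-B. x $ j *\<^sub>R (A *v edge_direction A B j))"
    by (simp add: linear_sum [OF matrix_vector_mul_linear] matrix_vector_mult_scaleR)
  then have "A *v ?v = 0"
    using assms
    by (simp add: matrix_vector_mult_diff_distrib mult_basic_solution mult_edge_direction)
  ultimately have "?v = 0"
    by (rule basis_kernel_trivial [OF assms(1)])
  then show ?thesis
    by (simp add: algebra_simps)
qed

lemma optimal_set_iff:
  "x \<in> optimal_set X c \<longleftrightarrow> x \<in> X \<and> (\<forall>y\<in>X. c \<bullet> x \<le> c \<bullet> y)"
  by (auto simp: optimal_set_def is_arg_min_linorder)

lemma optimal_if_reduced_costs_nonneg:
  fixes A :: "real^'d^'m"
  assumes "is_basis A B" and "basic_solution A b B \<in> feasible_set A b"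
    and nonneg: "\<And>j. j \<notin> B \<Longrightarrow> 0 \<le> c \<bullet> edge_direction A B j"
  shows "basic_solution A b B \<in> optimal_set (feasible_set A b) c"
proof -
  have "c \<bullet> basic_solution A b B \<le> c \<bullet> x" if x: "x \<in> feasible_set A b" for x
  proof -
    have "c \<bullet> x = c \<bullet> basic_solution A b B + (\<Sum>j\<in>-B. x $ j * (c \<bullet> edge_direction A B j))"
      using x by (subst feasible_eq_basic_solution_plus_edges [OF assms(1), of x b])
        (auto simp: feasible_set_def inner_add_right inner_sum_right)
    moreover have "0 \<le> (\<Sum>j\<in>-B. x $ j * (c \<bullet> edge_direction A B j))"
      using x nonneg by (intro sum_nonneg mult_nonneg_nonneg) (auto simp: feasible_set_def)
    ultimately show ?thesis
      by simp
  qed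
  then show ?thesis
    using assms(2) by (simp add: optimal_set_iff)
qed


section \<open>Vertices of a nondegenerate polytope\<close>

text \<open>A coordinate that decreases along \<open>v\<close> starts positive, and there are finitely many coordinates.\<close>

lemma feasible_small_step:
  fixes A :: "real^'d^'m"
  assumes "x \<in> feasible_set A b" and "A *v v = 0"
    and "\<And>i. x $ i > 0 \<or> v $ i \<ge> 0"
  obtains t where "t > 0" and "x + t *\<^sub>R v \<in> feasible_set A b"
proof -
  have "\<forall>\<^sub>F t in at_right 0. 0 \<le> x $ i + t * v $ i" for i
  proof (cases "x $ i > 0")
    case True
    have "((\<lambda>t. x $ i + t * v $ i) \<longlongrightarrow> x $ i + 0 * v $ i) (at_right 0)"
      by (intro tendsto_intros)
    then have "\<forall>\<^sub>F t in at_right 0. 0 < x $ i + t * v $ i"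
      using True by (intro order_tendstoD) auto
    then show ?thesis
      by eventually_elim simp
  next
    case False
    then have "v $ i \<ge> 0" and "x $ i \<ge> 0"
      using assms by (auto simp: feasible_set_def)
    then show ?thesis
      using eventually_at_right_less [of 0] by (auto elim!: eventually_mono)
  qed
  then have "\<forall>\<^sub>F t in at_right 0. \<forall>i. 0 \<le> x $ i + t * v $ i"
    by (rule eventually_all_finite)
  then have "\<forall>\<^sub>F t in at_right (0::real). t > 0 \<and> (\<forall>i. 0 \<le> x $ i + t * v $ i)"
    using eventually_at_right_less [of "0::real"] by eventually_elim simp
  then obtain t :: real where t: "t > 0" "\<forall>i. 0 \<le> x $ i + t * v $ i"
    using eventually_happens' [OF trivial_limit_at_right_real] by blast
  then have "x + t *\<^sub>R v \<in> feasible_set A b"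
    using assms(1,2)
    by (auto simp: feasible_set_def matrix_vector_right_distrib matrix_vector_mult_scaleR)
  with t(1) show thesis
    by (rule that)
qed

lemma convex_feasible_set: "convex (feasible_set A b)"
  by (auto simp: convex_def feasible_set_def matrix_vector_right_distrib
      matrix_vector_mult_scaleR simp flip: scaleR_left_distrib)

lemma compact_feasible_set:
  assumes "bounded (feasible_set A b)"
  shows "compact (feasible_set A b)"
proof -
  have "closed {x. A *v x = b}"
    by (intro closed_Collect_eq continuous_intros matrix_vector_mult_linear_continuous_on)
  moreover have "closed {x :: real^'a. \<forall>i. 0 \<le> x $ i}"
    by (intro closed_Collect_all closed_Collect_le continuous_intros)
  moreover have "feasible_set A b = {x. A *v x = b} \<inter> {x. \<forall>i. 0 \<le> x $ i}"
    by (auto simp: feasible_set_def)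
  ultimately show ?thesis
    using assms by (simp add: compact_eq_bounded_closed closed_Int)
qed

text \<open>If \<open>basic_solution A b B\<close> is strictly between two feasible points, then both vanish off \<open>B\<close> by
  nonnegativity, so they solve the same invertible system.\<close>

lemma basic_solution_extreme:
  fixes A :: "real^'d^'m"
  assumes "is_basis A B" and "basic_solution A b B \<in> feasible_set A b"
  shows "basic_solution A b B extreme_point_of feasible_set A b"
  unfolding extreme_point_of_def
proof (intro conjI ballI notI)
  fix y z
  assume y: "y \<in> feasible_set A b" and z: "z \<in> feasible_set A b"
    and seg: "basic_solution A b B \<in> open_segment y z"
  from seg obtain u where "y \<noteq> z" and u: "0 < u" "u < 1"
    and eq: "basic_solution A b B = (1 - u) *\<^sub>R y + u *\<^sub>R z"
    by (auto simp: in_segment)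
  have "(y - z) $ i = 0" if "i \<notin> B" for i
  proof -
    have "0 \<le> y $ i" "0 \<le> z $ i"
      using y z by (auto simp: feasible_set_def)
    moreover have "(1 - u) * y $ i + u * z $ i = 0"
      using arg_cong [OF eq, of "\<lambda>x. x $ i"] that by (simp add: basic_solution_outside)
    ultimately have "(1 - u) * y $ i = 0 \<and> u * z $ i = 0"
      using u by (simp add: add_nonneg_eq_0_iff)
    then show ?thesis
      using u by simp
  qed
  moreover have "A *v (y - z) = 0"
    using y z by (auto simp: feasible_set_def matrix_vector_mult_diff_distrib)
  ultimately have "y - z = 0"
    by (rule basis_kernel_trivial [OF assms(1)])
  with \<open>y \<noteq> z\<close> show False
    by simp
qed (rule assms(2))

lemma basic_solution_positive:
  fixes A :: "real^'d^'m"
  assumes "nondegenerate A b" and "is_basis A B"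
    and "basic_solution A b B \<in> feasible_set A b" and "i \<in> B"
  shows "basic_solution A b B $ i > 0"
proof -
  let ?P = "{i. 0 < basic_solution A b B $ i}"
  have "card ?P = CARD('m)"
    using assms(1) basic_solution_extreme [OF assms(2,3)] by (simp add: nondegenerate_def)
  moreover have "card B = CARD('m)"
    using assms(2) by (simp add: is_basis_def)
  moreover have "?P \<subseteq> B"
    by (auto simp: basic_solution_def split: if_splits)
  ultimately have "?P = B"
    by (intro card_subset_eq) auto
  with assms(4) show ?thesis
    by blast
qed

lemma edge_small_step:
  fixes A :: "real^'d^'m"
  assumes "nondegenerate A b" and "is_basis A B"
    and "basic_solution A b B \<in> feasible_set A b" and "j \<notin> B"
  obtains t where "t > 0"
    and "basic_solution A b B + t *\<^sub>R edge_direction A B j \<in> feasible_set A b"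
proof (rule feasible_small_step [OF assms(3) mult_edge_direction [OF assms(2,4)]])
  show "basic_solution A b B $ i > 0 \<or> edge_direction A B j $ i \<ge> 0" for i
  proof (cases "i \<in> B")
    case False
    then show ?thesis
      by (simp add: edge_direction_outside)
  qed (simp add: basic_solution_positive [OF assms(1-3)])
qed (rule that)

lemma reduced_cost_nonneg:
  fixes A :: "real^'d^'m"
  assumes "nondegenerate A b" and "optimal_feasible_basis A b c B" and "j \<notin> B"
  shows "0 \<le> c \<bullet> edge_direction A B j"
proof -
  let ?x = "basic_solution A b B"
  have B: "is_basis A B" and opt: "?x \<in> optimal_set (feasible_set A b) c"
    using assms(2) by (auto simp: optimal_feasible_basis_def)
  then have feas: "?x \<in> feasible_set A b"
    by (simp add: optimal_set_iff)
  obtain t where t: "t > 0" "?x + t *\<^sub>R edge_direction A B j \<in> feasible_set A b"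
    by (rule edge_small_step [OF assms(1) B feas assms(3)])
  then have "c \<bullet> ?x \<le> c \<bullet> (?x + t *\<^sub>R edge_direction A B j)"
    using opt by (simp add: optimal_set_iff)
  with t(1) show ?thesis
    by (simp add: inner_add_right zero_le_mult_iff)
qed

text \<open>A nonzero kernel vector of \<open>A\<close> supported in the support of \<open>x\<close> would let \<open>x\<close> move in both opposite
  directions within the polytope. So the columns in the support of an extreme point are independent;
  nondegeneracy provides that there are \<open>m\<close> of them.\<close>

lemma extreme_point_support_basis:
  fixes A :: "real^'d^'m"
  assumes "nondegenerate A b" and ext: "x extreme_point_of feasible_set A b"
  defines "B \<equiv> {i. 0 < x $ i}"
  shows "is_basis A B" and "basic_solution A b B = x"
proof -
  have x: "x \<in> feasible_set A b"
    using ext by (simp add: extreme_point_of_def)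
  have card: "card B = CARD('m)"
    unfolding B_def using assms(1) ext by (simp add: nondegenerate_def)
  note bij = basis_enum_bij [OF card]
  have outside: "x $ i = 0" if "i \<notin> B" for i
    using x that by (simp add: B_def feasible_set_def) (metis antisym_conv2)
  have kernel: "v = 0" if Av: "A *v v = 0" and supp: "\<And>i. i \<notin> B \<Longrightarrow> v $ i = 0" for v
  proof (rule ccontr)
    assume "v \<noteq> 0"
    have pos: "x $ i > 0 \<or> v $ i \<ge> 0" "x $ i > 0 \<or> (- v) $ i \<ge> 0" for i
      by (cases "i \<in> B"; use supp [of i] in \<open>simp add: B_def\<close>)+
    obtain t where t: "t > 0" "x + t *\<^sub>R v \<in> feasible_set A b"
      by (rule feasible_small_step [OF x Av pos(1)])
    have Amv: "A *v (- v) = 0"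
      using Av linear_neg [OF matrix_vector_mul_linear, of A v] by simp
    obtain s where s: "s > 0" "x + s *\<^sub>R (- v) \<in> feasible_set A b"
      by (rule feasible_small_step [OF x Amv pos(2)])
    have "x \<in> open_segment (x + t *\<^sub>R v) (x + s *\<^sub>R (- v))"
      unfolding in_segment
      \<comment> \<open>The weight \<open>t / (t + s)\<close> makes the two displacements along \<open>v\<close> cancel.\<close>
    proof (intro conjI exI)
      have "x + t *\<^sub>R v = x + s *\<^sub>R (- v) \<longleftrightarrow> (t + s) *\<^sub>R v = 0"
        by (auto simp: scaleR_left_distrib add_eq_0_iff)
      then show "x + t *\<^sub>R v \<noteq> x + s *\<^sub>R (- v)"
        using \<open>v \<noteq> 0\<close> s t by auto
      show "0 < t / (t + s)" "t / (t + s) < 1"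
        using s t by (auto simp: field_simps)
      have "(1 - t / (t + s)) * t - t / (t + s) * s = 0"
        using s t by (simp add: field_simps)
      moreover have "(1 - t / (t + s)) *\<^sub>R (x + t *\<^sub>R v) + (t / (t + s)) *\<^sub>R (x + s *\<^sub>R - v)
          = x + ((1 - t / (t + s)) * t - t / (t + s) * s) *\<^sub>R v"
        by (simp add: algebra_simps)
      ultimately show "x = (1 - t / (t + s)) *\<^sub>R (x + t *\<^sub>R v) + (t / (t + s)) *\<^sub>R (x + s *\<^sub>R - v)"
        by simp
    qed
    with s t ext show False
      by (auto simp: extreme_point_of_def)
  qed
  have "w = 0" if w: "basis_matrix A B *v w = 0" for w
  proof -
    let ?v = "\<chi> i. if i \<in> B then w $ inv_into UNIV (basis_enum B) i else 0"
    have eq: "(\<chi> k. ?v $ basis_enum B k) = w"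
      using bij by (auto simp: vec_eq_iff bij_betw_def)
    have "A *v ?v = basis_matrix A B *v (\<chi> k. ?v $ basis_enum B k)"
      by (rule mult_supported_on_basis [OF card]) simp
    then have "?v = 0"
      using w eq by (intro kernel) auto
    then show "w = 0"
      using eq by (simp add: vec_eq_iff)
  qed
  then have "invertible (basis_matrix A B)"
    by (metis matrix_left_invertible_ker invertible_left_inverse)
  with card show B: "is_basis A B"
    by (simp add: is_basis_def)
  have "A *v (basic_solution A b B - x) = 0"
    using x by (simp add: matrix_vector_mult_diff_distrib mult_basic_solution [OF B] feasible_set_def)
  then have "basic_solution A b B - x = 0"
    by (rule kernel) (simp add: basic_solution_outside outside)
  then show "basic_solution A b B = x"
    by simp
qed


section \<open>Optimal faces\<close>

lemma optimal_set_compact_convex_face: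
  fixes X :: "(real^'d) set"
  assumes "compact X" and "convex X" and "X \<noteq> {}"
  shows "compact (optimal_set X w)" and "optimal_set X w face_of X" and "optimal_set X w \<noteq> {}"
proof -
  have "continuous_on X (\<lambda>y. w \<bullet> y)"
    by (intro continuous_intros)
  then obtain x where x: "x \<in> X" "\<forall>y\<in>X. w \<bullet> x \<le> w \<bullet> y"
    using continuous_attains_inf [OF assms(1,3)] by blast
  then show "optimal_set X w \<noteq> {}"
    using optimal_set_iff by blast
  have eq: "optimal_set X w = X \<inter> {y. w \<bullet> y = w \<bullet> x}"
    using x by (auto simp: optimal_set_iff intro: antisym)
  show "compact (optimal_set X w)"
    unfolding eq using assms(1) by (intro compact_Int_closed closed_hyperplane)
  show "optimal_set X w face_of X"
    unfolding eq using x(2) by (intro face_of_Int_supporting_hyperplane_ge assms(2)) auto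
qed

text \<open>An optimal face is the convex hull of its vertices, which are optimal vertices of the whole
  polytope. A convex hull lies in every translate of a subspace that contains its generators.\<close>

lemma optimal_difference_in_direction_space:
  fixes X :: "(real^'d) set"
  assumes X: "compact X" "convex X"
    and "w \<in> C" and x: "x \<in> optimal_set X w" and y: "y \<in> optimal_set X w"
  shows "x - y \<in> direction_space (optimal_vertices X C)"
proof -
  let ?F = "optimal_set X w" and ?W = "direction_space (optimal_vertices X C)"
  let ?E = "{e. e extreme_point_of ?F}"
  have "X \<noteq> {}"
    using x by (auto simp: optimal_set_iff)
  note face = optimal_set_compact_convex_face [OF X this, of w]
  have W: "subspace ?W"
    by (simp add: direction_space_def)
  have "convex hull ?E = ?F"
    by (rule Krein_Milman_Minkowski [OF face(1) face_of_imp_convex [OF face(2)], symmetric])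
  then have xy: "x \<in> convex hull ?E" "y \<in> convex hull ?E"
    using x y by simp_all
  have E: "?E \<subseteq> optimal_vertices X C"
    using \<open>w \<in> C\<close> extreme_point_of_face [OF face(2)] by (auto simp: optimal_vertices_def)
  obtain e where e: "e \<in> ?E"
    using xy(1) by (cases "?E = {}") auto
  have "?E \<subseteq> (+) e ` ?W"
  proof
    fix f assume "f \<in> ?E"
    then have "f - e \<in> ?W"
      using E e unfolding direction_space_def by (intro span_base) auto
    then show "f \<in> (+) e ` ?W"
      by (intro image_eqI [of _ _ "f - e"]) auto
  qed
  then have "convex hull ?E \<subseteq> (+) e ` ?W"
    by (intro hull_minimal convex_translation subspace_imp_convex W)
  then obtain u v where "x = e + u" "u \<in> ?W" "y = e + v" "v \<in> ?W"
    using xy by blast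
  then show ?thesis
    using subspace_diff [OF W] by simp
qed

lemma optimal_feasible_basis_exists:
  fixes A :: "real^'d^'m"
  assumes "feasible_set A b \<noteq> {}" and "bounded (feasible_set A b)" and "nondegenerate A b"
  shows "\<exists>B. optimal_feasible_basis A b c B"
proof -
  let ?F = "optimal_set (feasible_set A b) c"
  note face = optimal_set_compact_convex_face
      [OF compact_feasible_set [OF assms(2)] convex_feasible_set assms(1), of c]
  obtain x where x: "x extreme_point_of ?F"
    using extreme_point_exists_convex face face_of_imp_convex convex_feasible_set by metis
  then have "x extreme_point_of feasible_set A b" "x \<in> ?F"
    using extreme_point_of_face [OF face(2)] by auto
  with extreme_point_support_basis [OF assms(3)] show ?thesis
    unfolding optimal_feasible_basis_def by metis
qed


section \<open>The iteration\<close>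

lemma mem_fiber_measurements:
  "v \<in> fiber C D (measurements c D) \<longleftrightarrow> v \<in> C \<and> (\<forall>q\<in>D. q \<bullet> v = q \<bullet> c)"
  by (auto simp: fiber_def measurements_def)

lemma min_value_nonneg_iff: "0 \<le> min_value K \<delta> \<longleftrightarrow> (\<forall>v\<in>K. 0 \<le> v \<bullet> \<delta>)"
  by (simp add: min_value_def le_INF_iff)

lemma minimizer_choice_exists: "\<exists>v. minimizer_choice K \<delta> v"
proof (cases "\<exists>w. is_arg_min (\<lambda>c'. c' \<bullet> \<delta>) (\<lambda>c'. c' \<in> K) w")
  case False
  then show ?thesis
    using min_value_nonneg_iff [of K \<delta>] by (auto simp: minimizer_choice_def not_le not_less)
qed (auto simp: minimizer_choice_def)

lemma minimizer_choice_negative: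
  assumes "minimizer_choice K \<delta> v" and "min_value K \<delta> < 0"
  shows "v \<in> K" and "v \<bullet> \<delta> < 0"
proof -
  have "v \<in> K \<and> v \<bullet> \<delta> < 0"
  proof (cases "\<exists>w. is_arg_min (\<lambda>c'. c' \<bullet> \<delta>) (\<lambda>c'. c' \<in> K) w")
    case True
    then have "v \<in> K" "\<forall>w\<in>K. v \<bullet> \<delta> \<le> w \<bullet> \<delta>"
      using assms(1) by (auto simp: minimizer_choice_def is_arg_min_linorder)
    moreover obtain w where "w \<in> K" "w \<bullet> \<delta> < 0"
      using assms(2) min_value_nonneg_iff [of K \<delta>] by (meson not_le)
    ultimately show ?thesis
      by force
  qed (use assms in \<open>auto simp: minimizer_choice_def\<close>)
  then show "v \<in> K" and "v \<bullet> \<delta> < 0"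
    by auto
qed

text \<open>With \<open>\<alpha>\<close> the minimal hit ratio, \<open>(1 - \<alpha>) c + \<alpha> v\<close> is the last cost vector on the segment from \<open>c\<close>
  to \<open>v\<close> for which all reduced costs \<open>\<delta> j\<close> are still nonnegative.\<close>

lemma facet_hit:
  fixes c v :: "real^'d"
  assumes nonneg: "\<And>j. j \<in> N \<Longrightarrow> 0 \<le> c \<bullet> \<delta> j"
    and min: "is_arg_min (\<lambda>j. hit_ratio c v (\<delta> j)) (\<lambda>j. j \<in> N \<and> v \<bullet> \<delta> j < 0) k"
  defines "\<alpha> \<equiv> hit_ratio c v (\<delta> k)"
  defines "w \<equiv> (1 - \<alpha>) *\<^sub>R c + \<alpha> *\<^sub>R v"
  shows "0 \<le> \<alpha>" and "\<alpha> \<le> 1" and "w \<bullet> \<delta> k = 0" and "\<And>j. j \<in> N \<Longrightarrow> 0 \<le> w \<bullet> \<delta> j"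
proof -
  have k: "k \<in> N" "v \<bullet> \<delta> k < 0"
    and le: "\<And>j. j \<in> N \<Longrightarrow> v \<bullet> \<delta> j < 0 \<Longrightarrow> \<alpha> \<le> hit_ratio c v (\<delta> j)"
    using min by (auto simp: is_arg_min_linorder \<alpha>_def)
  have w: "w \<bullet> \<delta> j = c \<bullet> \<delta> j - \<alpha> * (c \<bullet> \<delta> j - v \<bullet> \<delta> j)" for j
    by (simp add: w_def inner_add_left algebra_simps)
  show \<alpha>: "0 \<le> \<alpha>" "\<alpha> \<le> 1"
    using k nonneg [of k] by (auto simp: \<alpha>_def hit_ratio_def)
  show "w \<bullet> \<delta> k = 0"
    using k nonneg [of k] by (simp add: w) (simp add: \<alpha>_def hit_ratio_def)
  show "0 \<le> w \<bullet> \<delta> j" if j: "j \<in> N" for j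
  proof (cases "v \<bullet> \<delta> j < 0")
    case True
    then have "\<alpha> * (c \<bullet> \<delta> j - v \<bullet> \<delta> j) \<le> c \<bullet> \<delta> j"
      using le [OF j True] nonneg [OF j] by (simp add: hit_ratio_def pos_le_divide_eq)
    then show ?thesis
      by (simp add: w)
  next
    case False
    then have "0 \<le> (1 - \<alpha>) * (c \<bullet> \<delta> j) + \<alpha> * (v \<bullet> \<delta> j)"
      using \<alpha> nonneg [OF j] by simp
    then show ?thesis
      by (simp add: w algebra_simps)
  qed
qed

text \<open>The query leaves the span of the dataset because \<open>c\<^sup>o\<^sup>u\<^sup>t - c\<close> is orthogonal to that span but not to
  the query; it is in the direction space because at the facet hit it joins two optimal points.\<close>

lemma query_new_direction:
  fixes A :: "real^'d^'m"
  assumes bounded: "bounded (feasible_set A b)" and nondeg: "nondegenerate A b"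
    and C: "convex C" "c \<in> C"
    and step: "iteration A b C c (Running D) (Running D')"
  obtains q where "D' = insert q D" and "q \<notin> span D"
    and "q \<in> direction_space (optimal_vertices (feasible_set A b) C)"
  using step
proof cases
  case (query B K cout j0 jstar)
  let ?X = "feasible_set A b" and ?\<delta> = "edge_direction A B"
  let ?x = "basic_solution A b B" and ?v = "cout j0" and ?q = "edge_direction A B jstar"
  have B: "is_basis A B" and feas: "?x \<in> ?X"
    using query(2) by (auto simp: optimal_feasible_basis_def optimal_set_iff)
  have j0: "j0 \<in> -B"
    using query(5) by (simp add: is_arg_min_def)
  have jstar: "jstar \<notin> B" "?v \<bullet> ?q < 0"
    using query(7) by (auto simp: is_arg_min_def)
  have v: "?v \<in> C" "\<forall>p\<in>D. p \<bullet> ?v = p \<bullet> c"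
    using minimizer_choice_negative(1) [OF _ query(6)] query(3,4) j0
    by (auto simp: mem_fiber_measurements)
  have nonneg: "\<And>j. j \<in> -B \<Longrightarrow> 0 \<le> c \<bullet> ?\<delta> j"
    using reduced_cost_nonneg [OF nondeg query(2)] by auto
  have "?q \<notin> span D"
  proof
    assume "?q \<in> span D"
    moreover have "orthogonal (?v - c) p" if "p \<in> D" for p
      using v(2) that by (simp add: orthogonal_def inner_commute [of _ p] inner_diff_right)
    ultimately have "orthogonal (?v - c) ?q"
      by (rule orthogonal_to_span)
    then show False
      using jstar nonneg [of jstar] by (simp add: orthogonal_def inner_diff_left)
  qed
  moreover have "?q \<in> direction_space (optimal_vertices ?X C)"
  proof -
    let ?\<alpha> = "hit_ratio c ?v ?q"
    let ?w = "(1 - ?\<alpha>) *\<^sub>R c + ?\<alpha> *\<^sub>R ?v"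
    note hit = facet_hit [of "-B", OF nonneg query(7)]
    have "?w \<in> C"
      using hit(1,2) v(1) C by (intro convexD) auto
    have opt: "?x \<in> optimal_set ?X ?w"
      using hit(4) by (intro optimal_if_reduced_costs_nonneg B feas) auto
    obtain t where t: "t > 0" "?x + t *\<^sub>R ?q \<in> ?X"
      by (rule edge_small_step [OF nondeg B feas jstar(1)])
    then have "?x + t *\<^sub>R ?q \<in> optimal_set ?X ?w"
      using opt hit(3) by (simp add: optimal_set_iff inner_add_right)
    from optimal_difference_in_direction_space
      [OF compact_feasible_set [OF bounded] convex_feasible_set \<open>?w \<in> C\<close> this opt]
    have "t *\<^sub>R ?q \<in> direction_space (optimal_vertices ?X C)"
      by simp
    then have "(1 / t) *\<^sub>R t *\<^sub>R ?q \<in> direction_space (optimal_vertices ?X C)"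
      unfolding direction_space_def by (rule span_scale)
    with t(1) show ?thesis
      by simp
  qed
  ultimately show thesis
    using query(1) that by blast
qed

lemma iteration_possible:
  fixes A :: "real^'d^'m"
  assumes "feasible_set A b \<noteq> {}" and "bounded (feasible_set A b)" and "nondegenerate A b"
  shows "\<exists>s. iteration A b C c (Running D) s"
proof -
  obtain B where B: "optimal_feasible_basis A b c B"
    using optimal_feasible_basis_exists [OF assms] by blast
  let ?K = "fiber C D (measurements c D)" and ?\<delta> = "edge_direction A B"
  let ?m = "\<lambda>j. min_value ?K (?\<delta> j)"
  show ?thesis
  proof (cases "0 \<le> (INF j\<in>-B. ?m j)")
    case True
    with B show ?thesis
      by (blast intro: iteration.stop)
  next
    case False
    then obtain j where j: "j \<in> -B" "?m j < 0"
      by (auto simp: le_INF_iff not_le)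
    then obtain j0 where j0: "is_arg_min ?m (\<lambda>j. j \<in> -B) j0"
      using ex_is_arg_min_if_finite [of "-B" ?m] by auto
    have neg: "?m j0 < 0"
      using j0 j by (auto simp: is_arg_min_linorder intro: le_less_trans)
    obtain cout where cout: "\<forall>j\<in>-B. minimizer_choice ?K (?\<delta> j) (cout j)"
      using bchoice [of "-B" "\<lambda>j. minimizer_choice ?K (?\<delta> j)"] minimizer_choice_exists by auto
    let ?N = "{j. j \<in> -B \<and> cout j0 \<bullet> ?\<delta> j < 0}"
    have "j0 \<in> ?N"
      using minimizer_choice_negative(2) [OF _ neg] cout j0 by (auto simp: is_arg_min_def)
    then have "?N \<noteq> {}"
      by blast
    from ex_is_arg_min_if_finite [OF finite this, of "\<lambda>j. hit_ratio c (cout j0) (?\<delta> j)"]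
    obtain jstar where "is_arg_min (\<lambda>j. hit_ratio c (cout j0) (?\<delta> j))
        (\<lambda>j. j \<in> -B \<and> cout j0 \<bullet> ?\<delta> j < 0) jstar"
      unfolding mem_Collect_eq by (rule exE)
    from iteration.query [OF B refl cout j0 neg this] show ?thesis
      by (rule exI)
  qed
qed

lemma returned_dataset_sufficient:
  fixes A :: "real^'d^'m"
  assumes "iteration A b C c (Running D) (Returned D' B x)"
  shows "D' = D" and "pointwise_sufficient (feasible_set A b) C c D"
proof -
  let ?K = "fiber C D (measurements c D)"
  have D: "D' = D" and opt: "optimal_feasible_basis A b c B"
    and inf: "0 \<le> (INF j\<in>-B. min_value ?K (edge_direction A B j))"
    using assms by (auto elim: iteration.cases)
  show "D' = D"
    by (fact D)
  have B: "is_basis A B" and feas: "basic_solution A b B \<in> feasible_set A b"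
    using opt by (auto simp: optimal_feasible_basis_def optimal_set_iff)
  have "basic_solution A b B \<in> optimal_set (feasible_set A b) c'" if "c' \<in> ?K" for c'
    using inf that
    by (intro optimal_if_reduced_costs_nonneg B feas) (auto simp: le_INF_iff min_value_nonneg_iff)
  with feas show "pointwise_sufficient (feasible_set A b) C c D"
    by (auto simp: pointwise_sufficient_def)
qed

lemma no_iteration_from_Returned: "\<not> iteration A b C c (Returned D B x) s"
  by (auto elim: iteration.cases)

text \<open>The initial dataset may be linearly dependent, so independence holds only for the set \<open>Q\<close> of
  queries made by the algorithm. Each query avoids the span of the whole current dataset, hence also
  the span of the earlier queries, and so \<open>card Q\<close> counts the iterations.\<close>

lemma queries_independent:
  fixes A :: "real^'d^'m"
  assumes "bounded (feasible_set A b)" and "nondegenerate A b" and "convex C" and "c \<in> C"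
    and "(iteration A b C c ^^ n) (Running Dinit) (Running D)"
  shows "\<exists>Q. D = Dinit \<union> Q \<and> finite Q \<and> card Q = n \<and> independent Q
    \<and> Q \<subseteq> direction_space (optimal_vertices (feasible_set A b) C)"
  using assms(5)
proof (induction n arbitrary: D)
  case 0
  then show ?case
    by (intro exI [of _ "{}"]) (simp add: independent_empty)
next
  case (Suc n)
  then obtain s where s: "(iteration A b C c ^^ n) (Running Dinit) s" "iteration A b C c s (Running D)"
    by (auto elim: relpowp_Suc_E)
  then obtain D0 where D0: "s = Running D0"
    by (cases s) (auto simp: no_iteration_from_Returned)
  from Suc.IH [OF s(1) [unfolded D0]] obtain Q where Q: "D0 = Dinit \<union> Q" "finite Q" "card Q = n"
    "independent Q" "Q \<subseteq> direction_space (optimal_vertices (feasible_set A b) C)"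
    by blast
  obtain q where q: "D = insert q D0" "q \<notin> span D0"
    "q \<in> direction_space (optimal_vertices (feasible_set A b) C)"
    by (rule query_new_direction [OF assms(1-4) s(2) [unfolded D0]])
  have new: "q \<notin> span Q"
    using q(2) Q(1) span_mono [of Q D0] by auto
  then have "q \<notin> Q"
    using span_base by auto
  with new q Q show ?case
    by (intro exI [of _ "insert q Q"]) (auto simp: independent_insert)
qed

theorem theorem21:
  fixes A :: "real^'d^'m" and b :: "real^'m"
    and C :: "(real^'d) set" and c :: "real^'d" and Dinit :: "(real^'d) set"
  assumes "feasible_set A b \<noteq> {}"
    and "bounded (feasible_set A b)"
    and "nondegenerate A b"
    and "rank A = CARD('m)"
    and "convex C"
    and "c \<in> C"
    and "finite Dinit"
    and "dstar = dim (direction_space (optimal_vertices (feasible_set A b) C))"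
  shows
    \<comment> \<open>no execution performs more than \<open>dstar + 1\<close> iterations\<close>
    "(\<forall>n s. (iteration A b C c ^^ n) (Running Dinit) s \<longrightarrow> n \<le> dstar + 1)
    \<comment> \<open>no execution gets stuck before returning\<close>
    \<and> (\<forall>n D. (iteration A b C c ^^ n) (Running Dinit) (Running D)
         \<longrightarrow> (\<exists>s. iteration A b C c (Running D) s))
    \<comment> \<open>every returned dataset is pointwise sufficient\<close>
    \<and> (\<forall>n D B x. (iteration A b C c ^^ n) (Running Dinit) (Returned D B x)
         \<longrightarrow> finite D \<and> pointwise_sufficient (feasible_set A b) C c D)"
proof (intro conjI allI impI)
  let ?W = "direction_space (optimal_vertices (feasible_set A b) C)"
  note queries = queries_independent [OF assms(2,3,5,6)]
  have running: "n \<le> dstar" if "(iteration A b C c ^^ n) (Running Dinit) (Running D)" for n D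
    using queries [OF that] independent_card_le_dim [of _ ?W] assms(8) by auto
  \<comment> \<open>A returned state has no successor, so only the last iteration can return.\<close>
  have predecessor: "\<exists>k D'. n = Suc k \<and> (iteration A b C c ^^ k) (Running Dinit) (Running D')
      \<and> iteration A b C c (Running D') (Returned D B x)"
    if "(iteration A b C c ^^ n) (Running Dinit) (Returned D B x)" for n D B x
  proof (cases n)
    case (Suc k)
    with that obtain s where s: "(iteration A b C c ^^ k) (Running Dinit) s"
      "iteration A b C c s (Returned D B x)"
      by (auto elim: relpowp_Suc_E)
    then show ?thesis
      using Suc by (cases s) (auto simp: no_iteration_from_Returned)
  qed (use that in auto)
  show "n \<le> dstar + 1" if "(iteration A b C c ^^ n) (Running Dinit) s" for n s
  proof (cases s)
    case (Running D)
    then show ?thesis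
      using running that by (simp add: le_SucI)
  next
    case (Returned D B x)
    then show ?thesis
      using predecessor running that by fastforce
  qed
  show "\<exists>s. iteration A b C c (Running D) s"
    if "(iteration A b C c ^^ n) (Running Dinit) (Running D)" for n D
    by (rule iteration_possible [OF assms(1-3)])
  show "finite D" and "pointwise_sufficient (feasible_set A b) C c D"
    if ret: "(iteration A b C c ^^ n) (Running Dinit) (Returned D B x)" for n D B x
  proof -
    obtain k D' where run: "(iteration A b C c ^^ k) (Running Dinit) (Running D')"
      and step: "iteration A b C c (Running D') (Returned D B x)"
      using predecessor [OF ret] by blast
    note suff = returned_dataset_sufficient [OF step]
    then show "pointwise_sufficient (feasible_set A b) C c D"
      by simp
    show "finite D"
      using queries [OF run] suff(1) assms(7) by auto
  qed
qed

end
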